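(* Define integers $a(n)$, $n \ge 0$, by the formal power series identity $$\sum_{n=0}^{\infty} a(n) q^n = \prod_{n=1}^{\infty} \frac{1}{(1-q^{3n})(1-q^n)^3}.$$ Then for every nonnegative integer $n$, $$a(15n+6) \equiv 0 \pmod{5} \quad\text{and}\quad a(15n+12) \equiv 0 \pmod{5}.$$ *)

theory Defs
  imports "HOL-Analysis.Infinite_Products"
    "HOL-Computational_Algebra.Formal_Power_Series"
    "HOL-Number_Theory.Cong"
begin

text \<open>The identity defining \<open>a\<close> is stated with the library's infinite product on rational
  formal power series, whose topology is that of coefficientwise stabilisation; the factor with
  index \<open>n \<ge> 1\<close> is at position \<open>k = n - 1\<close>. The main result here is
  \<open>ex1_product_expansion\<close>: exactly one integer sequence satisfies the identity, so
  quantifying over all \<open>a\<close> that do amounts to a definition of \<open>a\<close>.\<close>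

definition int_fps :: "rat fps \<Rightarrow> bool" where
  "int_fps f \<longleftrightarrow> (\<forall>n. fps_nth f n \<in> \<int>)"

lemma int_fps_one: "int_fps 1"
  by (simp add: int_fps_def)

lemma int_fps_mult: "int_fps f \<Longrightarrow> int_fps g \<Longrightarrow> int_fps (f * g)"
  by (auto simp: int_fps_def fps_mult_nth intro!: Ints_sum)

lemma int_fps_power: "int_fps f \<Longrightarrow> int_fps (f ^ k)"
  by (induction k) (auto simp: int_fps_one int_fps_mult)

lemma int_fps_prod: "(\<And>x. x \<in> A \<Longrightarrow> int_fps (f x)) \<Longrightarrow> int_fps (\<Prod>x\<in>A. f x)"
  by (induction A rule: infinite_finite_induct) (auto simp: int_fps_one int_fps_mult)

lemma int_fps_inverse:
  assumes "int_fps f" "fps_nth f 0 = 1"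
  shows "int_fps (inverse f)"
  unfolding int_fps_def
proof
  fix n
  have id: "f * inverse f = 1"
    using assms by (intro inverse_mult_eq_1') auto
  show "fps_nth (inverse f) n \<in> \<int>"
  proof (induction n rule: less_induct)
    case (less n)
    have "fps_nth (1 :: rat fps) n = (\<Sum>i=0..n. fps_nth f i * fps_nth (inverse f) (n - i))"
      by (subst id [symmetric]) (simp add: fps_mult_nth)
    also have "\<dots> = fps_nth (inverse f) n + (\<Sum>i=1..n. fps_nth f i * fps_nth (inverse f) (n - i))"
      by (subst sum.atLeast_Suc_atMost) (auto simp: assms)
    finally have "fps_nth (inverse f) n =
        fps_nth 1 n - (\<Sum>i=1..n. fps_nth f i * fps_nth (inverse f) (n - i))"
      by simp
    moreover have "(\<Sum>i=1..n. fps_nth f i * fps_nth (inverse f) (n - i)) \<in> \<int>"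
      using less assms by (intro Ints_sum Ints_mult) (auto simp: int_fps_def)
    ultimately show ?case
      by simp
  qed
qed

lemma nth_one_factor:
  fixes f g :: "rat fps"
  assumes "\<And>n. n \<le> k \<Longrightarrow> fps_nth f n = fps_nth 1 n"
  assumes "\<And>n. n \<le> k \<Longrightarrow> fps_nth g n = fps_nth 1 n"
  assumes "n \<le> k"
  shows "fps_nth (f * g) n = fps_nth 1 n"
proof -
  have "fps_nth (f * g) n = fps_nth (1 * 1 :: rat fps) n"
    unfolding fps_mult_nth using assms by (intro sum.cong) auto
  thus ?thesis by simp
qed

lemma ex1_product_expansion:
  "\<exists>!a :: nat \<Rightarrow> int.
    (\<lambda>k. 1 / ((1 - fps_X ^ (3 * Suc k)) * (1 - fps_X ^ Suc k) ^ 3))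
      has_prod (Abs_fps (\<lambda>n. of_int (a n)) :: rat fps)"
proof -
  define D :: "nat \<Rightarrow> rat fps"
    where "D = (\<lambda>k. (1 - fps_X ^ (3 * Suc k)) * (1 - fps_X ^ Suc k) ^ 3)"
  define F where "F = (\<lambda>k. 1 / D k)"
  have D0: "fps_nth (D k) 0 = 1" for k
    by (simp add: D_def fps_power_zeroth)
  have F: "F k = inverse (D k)" for k
    unfolding F_def using D0[of k] by (subst fps_divide_unit) auto
  have DF: "D k * F k = 1" for k
    unfolding F using D0[of k] by (intro inverse_mult_eq_1') auto
  have low: "fps_nth (D k) n = fps_nth 1 n" if "n \<le> k" for n k
  proof -
    have A: "fps_nth (1 - fps_X ^ j :: rat fps) n = fps_nth 1 n" if "n \<le> k" "k < j" for n j
      using that by auto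
    have B: "fps_nth ((1 - fps_X ^ Suc k :: rat fps) ^ i) n = fps_nth 1 n" if "n \<le> k" for n i
      using that
    proof (induction i arbitrary: n)
      case (Suc i)
      show ?case unfolding power_Suc
        by (rule nth_one_factor[of k]) (use A Suc in auto)
    qed auto
    show ?thesis unfolding D_def
      by (rule nth_one_factor[of k]) (use A B that in auto)
  qed
  have lowF: "fps_nth (F k) n = fps_nth 1 n" if "n \<le> k" for n k
  proof -
    have "fps_nth (D k * F k) n = fps_nth (1 * F k) n"
      unfolding fps_mult_nth using low[of _ k] that by (intro sum.cong) auto
    thus ?thesis by (simp add: DF)
  qed
  have intD: "int_fps (D k)" for k
    unfolding D_def by (intro int_fps_mult int_fps_power) (auto simp: int_fps_def)
  have intF: "int_fps (F k)" for k
    unfolding F by (intro int_fps_inverse intD D0)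
  define Q where "Q = (\<lambda>m. \<Prod>k\<le>m. F k)"
  have intQ: "int_fps (Q m)" for m
    unfolding Q_def by (intro int_fps_prod intF)
  have stab: "fps_nth (Q m) n = fps_nth (Q n) n" if "n \<le> m" for m n
    using that
  proof (induction m rule: dec_induct)
    case (step m)
    have "fps_nth (Q (Suc m)) n = fps_nth (Q m * F (Suc m)) n"
      by (simp add: Q_def)
    also have "\<dots> = fps_nth (Q m * 1) n"
      unfolding fps_mult_nth using lowF[of _ "Suc m"] step.hyps
      by (intro sum.cong) auto
    finally show ?case using step.IH by simp
  qed auto
  define a where "a = (\<lambda>n. \<lfloor>fps_nth (Q n) n\<rfloor>)"
  define P :: "rat fps" where "P = Abs_fps (\<lambda>n. of_int (a n))"
  have P: "fps_nth P n = fps_nth (Q n) n" for n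
    using intQ[of n] by (simp add: P_def a_def int_fps_def)
  have lim: "Q \<longlonglongrightarrow> P"
  proof (rule tendsto_fpsI)
    fix n
    show "\<forall>\<^sub>F m in sequentially. fps_nth (Q m) n = fps_nth P n"
      using eventually_ge_at_top[of n] by eventually_elim (use stab P in metis)
  qed
  have "fps_nth P 0 = 1"
    using lowF[of 0 0] P[of 0] by (simp add: Q_def)
  hence "P \<noteq> 0" by auto
  hence FP: "F has_prod P"
    using lim by (auto simp: has_prod_def raw_has_prod_def Q_def)
  have "\<exists>!a :: nat \<Rightarrow> int. F has_prod (Abs_fps (\<lambda>n. of_int (a n)))"
  proof (rule ex1I[of _ a])
    show "F has_prod (Abs_fps (\<lambda>n. of_int (a n)))"
      using FP by (simp only: P_def)
  next
    fix b :: "nat \<Rightarrow> int" assume "F has_prod (Abs_fps (\<lambda>n. of_int (b n)))"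
    hence "Abs_fps (\<lambda>n. of_int (b n)) = P"
      using FP by (rule has_prod_unique2)
    hence "(of_int (b n) :: rat) = of_int (a n)" for n
      by (simp add: P_def fps_eq_iff)
    thus "b = a"
      by auto
  qed
  thus ?thesis
    unfolding F_def D_def .
qed

end

theory Submission
  imports Defs
begin

text \<open>
  Writing \<open>1 / ((1 - q^(3j)) (1 - q^j)^3)\<close> as
  \<open>(1 - q^(3j))^9 / (1 - q^j)^3\<close> times \<open>((1 - q^(3j))^5)^(-2)\<close>, the second factor is modulo 5
  a power series in \<open>q^15\<close>, so only the product of the first factors matters. That product
  (the cube of the Borwein theta function \<open>c\<close>, up to normalisation) is a weight 3 Eisenstein
  series: its coefficient at \<open>q^n\<close> is the sum of \<open>chi(x) a^2\<close> over \<open>a x = n + 1\<close>, where \<open>chi\<close> is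
  the nontrivial character modulo 3. For \<open>n\<close> congruent to 6 or 12 modulo 15 the number
  \<open>N = n + 1\<close> is 1 modulo 3 and a quadratic nonresidue modulo 5, so that
  \<open>chi(a) = chi(x)\<close> and \<open>a^2 + x^2\<close> is divisible by 5 whenever \<open>a x = N\<close>.

  The Eisenstein series is identified through its logarithmic derivative. This needs a
  convolution identity for divisor sums, which is obtained by Liouville's method: on the
  solutions of \<open>a x + b y = n\<close>, one step of the Euclidean algorithm is a bijection between
  those with \<open>x > y\<close> and those with \<open>b > a\<close>.
\<close>

section \<open>Liouville's method for \<open>a x + b y = n\<close>\<close>

definition chi3 :: "int \<Rightarrow> int" where
  "chi3 x = (if x mod 3 = 1 then 1 else if x mod 3 = 2 then -1 else 0)"

text \<open>A divisor is kept together with its codivisor, so that exchanging the two is a symmetry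
  of the set.\<close>

definition factor_pairs :: "int \<Rightarrow> (int \<times> int) set" where
  "factor_pairs n = {(a, x). a > 0 \<and> x > 0 \<and> a * x = n}"

definition twisted_sigma :: "int \<Rightarrow> int" where
  "twisted_sigma n = (\<Sum>(a, x)\<in>factor_pairs n. chi3 x * a\<^sup>2)"

text \<open>\<open>\<Sum>n. log_coeff n q^n\<close> is the logarithmic derivative \<open>q f'/f\<close> of
  \<open>f = \<Prod>j. (1 - q^(3j))^9 / (1 - q^j)^3\<close>.\<close>

definition log_coeff :: "int \<Rightarrow> int" where
  "log_coeff n = (\<Sum>(b, y)\<in>factor_pairs n. 3 * b * (1 - 9 * of_bool (3 dvd y)))"

definition quads :: "int \<Rightarrow> (int \<times> int \<times> int \<times> int) set" where
  "quads n = {(a, b, x, y). a > 0 \<and> b > 0 \<and> x > 0 \<and> y > 0 \<and> a * x + b * y = n}"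

lemma finite_factor_pairs [simp]: "finite (factor_pairs n)"
proof (rule finite_subset)
  show "factor_pairs n \<subseteq> {1..n} \<times> {1..n}"
  proof clarify
    fix a x assume "(a, x) \<in> factor_pairs n"
    hence "a \<ge> 1" "x \<ge> 1" "a * x = n" by (auto simp: factor_pairs_def)
    moreover from this have "a * 1 \<le> a * x" "1 * x \<le> a * x"
      by (intro mult_mono; simp)+
    ultimately show "a \<in> {1..n} \<and> x \<in> {1..n}" by auto
  qed
qed auto

lemma quads_eq:
  "quads n = (\<lambda>(k, (a, x), (b, y)). (a, b, x, y)) `
     (SIGMA k:{1..n-1}. factor_pairs k \<times> factor_pairs (n - k))"
proof (intro set_eqI iffI)
  fix q assume "q \<in> quads n"
  then obtain a b x y where q: "q = (a, b, x, y)" "a > 0" "b > 0" "x > 0" "y > 0" "a * x + b * y = n"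
    by (auto simp: quads_def)
  have "a * x > 0" "b * y > 0" using q by simp_all
  hence "1 \<le> a * x" "1 \<le> b * y" by linarith+
  hence "(a * x, (a, x), (b, y)) \<in> (SIGMA k:{1..n-1}. factor_pairs k \<times> factor_pairs (n - k))"
    using q by (auto simp: factor_pairs_def)
  thus "q \<in> (\<lambda>(k, (a, x), (b, y)). (a, b, x, y)) `
     (SIGMA k:{1..n-1}. factor_pairs k \<times> factor_pairs (n - k))"
    unfolding q by (rule rev_image_eqI) simp
qed (auto simp: quads_def factor_pairs_def)

lemma finite_quads [simp]: "finite (quads n)"
  unfolding quads_eq by (intro finite_imageI finite_SigmaI) auto

text \<open>Grouping the solutions by \<open>k = a * x\<close> leaves independent factorisations of
  \<open>k\<close> and \<open>n - k\<close>; this is how Cauchy products of divisor sums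
  enter.\<close>

lemma sum_quads_product:
  "(\<Sum>(a, b, x, y)\<in>quads n. f a x * g b y) =
     (\<Sum>k\<in>{1..n-1}. (\<Sum>(a, x)\<in>factor_pairs k. f a x) * (\<Sum>(b, y)\<in>factor_pairs (n - k). g b y :: int))"
proof -
  have inj: "inj_on (\<lambda>(k, (a, x), (b, y)). (a, b, x, y))
      (SIGMA k:{1..n-1}. factor_pairs k \<times> factor_pairs (n - k))"
    by (auto simp: inj_on_def factor_pairs_def)
  have "(\<Sum>(a, b, x, y)\<in>quads n. f a x * g b y) =
     (\<Sum>(k, (a, x), (b, y))\<in>(SIGMA k:{1..n-1}. factor_pairs k \<times> factor_pairs (n - k)). f a x * g b y)"
    unfolding quads_eq sum.reindex[OF inj] by (simp add: case_prod_unfold o_def)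
  also have "\<dots> = (\<Sum>k\<in>{1..n-1}. \<Sum>((a, x), (b, y))\<in>factor_pairs k \<times> factor_pairs (n - k). f a x * g b y)"
    by (subst sum.Sigma) auto
  also have "\<dots> = (\<Sum>k\<in>{1..n-1}. (\<Sum>(a, x)\<in>factor_pairs k. f a x) * (\<Sum>(b, y)\<in>factor_pairs (n - k). g b y))"
    by (intro sum.cong refl) (simp add: sum_product sum.cartesian_product case_prod_unfold)
  finally show ?thesis .
qed

lemma sum_quads_swap:
  "(\<Sum>(a, b, x, y)\<in>quads n. f a b x y) = (\<Sum>(a, b, x, y)\<in>quads n. f b a y x :: int)"
  by (rule sum.reindex_bij_witness[of _ "\<lambda>(a, b, x, y). (b, a, y, x)" "\<lambda>(a, b, x, y). (b, a, y, x)"])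
     (auto simp: quads_def)

text \<open>The part with \<open>x < y\<close> is folded onto \<open>x > y\<close> by exchanging
  \<open>(a, x)\<close> with \<open>(b, y)\<close>.\<close>

lemma sum_quads_split_x:
  "(\<Sum>(a, b, x, y)\<in>quads n. f a b x y) =
     (\<Sum>(a, b, x, y)\<in>{(a, b, x, y)\<in>quads n. x > y}. f a b x y + f b a y x :: int) +
     (\<Sum>(a, b, x, y)\<in>{(a, b, x, y)\<in>quads n. x = y}. f a b x y)"
proof -
  let ?gt = "{(a, b, x, y)\<in>quads n. x > y}" and ?lt = "{(a, b, x, y)\<in>quads n. x < y}"
    and ?eq = "{(a, b, x, y)\<in>quads n. x = y}"
  have fin: "finite ?gt" "finite ?lt" "finite ?eq"
    by (rule finite_subset[OF _ finite_quads[of n]]; auto)+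
  have "quads n = ?gt \<union> ?lt \<union> ?eq"
    by auto
  hence "(\<Sum>(a, b, x, y)\<in>quads n. f a b x y) = (\<Sum>(a, b, x, y)\<in>?gt \<union> ?lt \<union> ?eq. f a b x y)"
    by simp
  also have "\<dots> = (\<Sum>(a, b, x, y)\<in>?gt. f a b x y) + (\<Sum>(a, b, x, y)\<in>?lt. f a b x y)
      + (\<Sum>(a, b, x, y)\<in>?eq. f a b x y)"
    using fin by (subst sum.union_disjoint; (subst sum.union_disjoint)?) auto
  also have "(\<Sum>(a, b, x, y)\<in>?lt. f a b x y) = (\<Sum>(a, b, x, y)\<in>?gt. f b a y x)"
    by (rule sum.reindex_bij_witness[of _ "\<lambda>(a, b, x, y). (b, a, y, x)" "\<lambda>(a, b, x, y). (b, a, y, x)"])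
       (auto simp: quads_def)
  finally show ?thesis
    by (simp add: sum.distrib case_prod_unfold)
qed

lemma sum_quads_split_a:
  assumes "\<And>a b x y. f a b x y = f b a y x"
  shows "(\<Sum>(a, b, x, y)\<in>quads n. f a b x y) =
     2 * (\<Sum>(a, b, x, y)\<in>{(a, b, x, y)\<in>quads n. b > a}. f a b x y :: int) +
     (\<Sum>(a, b, x, y)\<in>{(a, b, x, y)\<in>quads n. a = b}. f a b x y)"
proof -
  let ?gt = "{(a, b, x, y)\<in>quads n. b > a}" and ?lt = "{(a, b, x, y)\<in>quads n. b < a}"
    and ?eq = "{(a, b, x, y)\<in>quads n. a = b}"
  have fin: "finite ?gt" "finite ?lt" "finite ?eq"
    by (rule finite_subset[OF _ finite_quads[of n]]; auto)+
  have "quads n = ?gt \<union> ?lt \<union> ?eq"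
    by auto
  hence "(\<Sum>(a, b, x, y)\<in>quads n. f a b x y) = (\<Sum>(a, b, x, y)\<in>?gt \<union> ?lt \<union> ?eq. f a b x y)"
    by simp
  also have "\<dots> = (\<Sum>(a, b, x, y)\<in>?gt. f a b x y) + (\<Sum>(a, b, x, y)\<in>?lt. f a b x y)
      + (\<Sum>(a, b, x, y)\<in>?eq. f a b x y)"
    using fin by (subst sum.union_disjoint; (subst sum.union_disjoint)?) auto
  also have "(\<Sum>(a, b, x, y)\<in>?lt. f a b x y) = (\<Sum>(a, b, x, y)\<in>?gt. f a b x y)"
    by (rule sum.reindex_bij_witness[of _ "\<lambda>(a, b, x, y). (b, a, y, x)" "\<lambda>(a, b, x, y). (b, a, y, x)"])
       (use assms in \<open>auto simp: quads_def\<close>)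
  finally show ?thesis
    by (simp only: mult_2)
qed

text \<open>The Euclidean step: \<open>a * x + b * y = a * (x - y) + (a + b) * y\<close>, so
  \<open>(a, b, x, y)\<close> goes to \<open>(a, a + b, x - y, y)\<close>.\<close>

lemma sum_quads_euclid:
  "(\<Sum>(a, b, x, y)\<in>{(a, b, x, y)\<in>quads n. x > y}. f a b x y :: int) =
   (\<Sum>(a, b, x, y)\<in>{(a, b, x, y)\<in>quads n. b > a}. f a (b - a) (x + y) y)"
  by (rule sum.reindex_bij_witness[of _ "\<lambda>(a, b, x, y). (a, b - a, x + y, y)"
        "\<lambda>(a, b, x, y). (a, a + b, x - y, y)"])
     (auto simp: quads_def algebra_simps)

text \<open>On this diagonal \<open>(a + b) * x = n\<close>: with \<open>m = a + b\<close>, the pair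
  \<open>(m, x)\<close> is a factorisation of \<open>n\<close> and \<open>a\<close> is free below
  \<open>m\<close>.\<close>

lemma sum_quads_equal_x:
  "(\<Sum>(a, b, x, y)\<in>{(a, b, x, y)\<in>quads n. x = y}. f a b x y :: int) =
   (\<Sum>(m, x)\<in>factor_pairs n. \<Sum>a\<in>{1..m-1}. f a (m - a) x x)"
proof -
  have "(\<Sum>(m, x)\<in>factor_pairs n. \<Sum>a\<in>{1..m-1}. f a (m - a) x x) =
      (\<Sum>((m, x), a)\<in>(SIGMA p:factor_pairs n. {1..fst p - 1}). f a (m - a) x x)"
    by (simp add: case_prod_unfold sum.Sigma)
  also have "\<dots> = (\<Sum>(a, b, x, y)\<in>{(a, b, x, y)\<in>quads n. x = y}. f a b x y)"
    by (rule sum.reindex_bij_witness[of _ "\<lambda>(a, b, x, y). ((a + b, x), a)"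
        "\<lambda>((m, x), a). (a, m - a, x, x)"])
       (auto simp: quads_def factor_pairs_def algebra_simps)
  finally show ?thesis ..
qed

lemma sum_quads_equal_a:
  "(\<Sum>(a, b, x, y)\<in>{(a, b, x, y)\<in>quads n. a = b}. f a b x y :: int) =
   (\<Sum>(a, m)\<in>factor_pairs n. \<Sum>x\<in>{1..m-1}. f a a x (m - x))"
proof -
  have "(\<Sum>(a, m)\<in>factor_pairs n. \<Sum>x\<in>{1..m-1}. f a a x (m - x)) =
      (\<Sum>((a, m), x)\<in>(SIGMA p:factor_pairs n. {1..snd p - 1}). f a a x (m - x))"
    by (simp add: case_prod_unfold sum.Sigma)
  also have "\<dots> = (\<Sum>(a, b, x, y)\<in>{(a, b, x, y)\<in>quads n. a = b}. f a b x y)"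
    by (rule sum.reindex_bij_witness[of _ "\<lambda>(a, b, x, y). ((a, x + y), x)"
        "\<lambda>((a, m), x). (a, a, x, m - x)"])
       (auto simp: quads_def factor_pairs_def algebra_simps)
  finally show ?thesis ..
qed

text \<open>Folding and then the Euclidean step turn the \<open>x > y\<close> part of the sum of
  \<open>g\<close> into the sum of \<open>G\<close> over \<open>b > a\<close>. By symmetry, twice
  the latter is the full sum of \<open>G\<close> without its diagonal \<open>a = b\<close>. Hence
  only the two diagonals survive.\<close>

lemma sum_quads_identity:
  fixes g G :: "int \<Rightarrow> int \<Rightarrow> int \<Rightarrow> int \<Rightarrow> int"
  assumes G: "\<And>a b x y. G a b x y = g a (b - a) (x + y) y + g (b - a) a y (x + y)"
    and sym: "\<And>a b x y. G a b x y = G b a y x"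
  shows "(\<Sum>(a, b, x, y)\<in>quads n. 2 * g a b x y - G a b x y) =
    2 * (\<Sum>(m, x)\<in>factor_pairs n. \<Sum>a\<in>{1..m-1}. g a (m - a) x x) -
    (\<Sum>(a, m)\<in>factor_pairs n. \<Sum>x\<in>{1..m-1}. G a a x (m - x))"
proof -
  have "(\<Sum>(a, b, x, y)\<in>quads n. g a b x y) =
     (\<Sum>(a, b, x, y)\<in>{(a, b, x, y)\<in>quads n. b > a}. G a b x y) +
     (\<Sum>(a, b, x, y)\<in>{(a, b, x, y)\<in>quads n. x = y}. g a b x y)"
    unfolding sum_quads_split_x[of g] sum_quads_euclid G ..
  moreover note sum_quads_split_a[of G, OF sym]
  ultimately show ?thesis
    unfolding sum_quads_equal_x sum_quads_equal_a
    by (simp add: case_prod_unfold sum_subtractf flip: sum_distrib_left)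
qed

text \<open>The weight below was found by solving the linear system expressing that \<open>weight'\<close> is
  invariant under exchanging \<open>(a, x)\<close> with \<open>(b, y)\<close> and that \<open>2 weight - weight'\<close>
  symmetrises to the summand of the convolution of \<open>twisted_sigma\<close> with \<open>log_coeff\<close>.\<close>

definition phi3 :: "int \<Rightarrow> int \<Rightarrow> int" where
  "phi3 x y = (if 3 dvd x then -4 * chi3 y else if 3 dvd y then -4 * chi3 x
     else if x mod 3 = y mod 3 then 2 * chi3 x else - chi3 x)"

definition weight :: "int \<Rightarrow> int \<Rightarrow> int \<Rightarrow> int \<Rightarrow> int" where
  "weight a b x y = 3 * a\<^sup>2 * b * phi3 x y - 2 * a ^ 3 * chi3 x"

definition weight' :: "int \<Rightarrow> int \<Rightarrow> int \<Rightarrow> int \<Rightarrow> int" where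
  "weight' a b x y = weight a (b - a) (x + y) y + weight (b - a) a y (x + y)"

text \<open>Only the residues of \<open>x\<close> and \<open>y\<close> modulo 3 matter; each of the
  nine cases is a polynomial identity in \<open>a\<close> and \<open>b\<close>.\<close>

lemma
  weight'_sym: "weight' a b x y = weight' b a y x" and
  weight_sym: "2 * weight a b x y - weight' a b x y + (2 * weight b a y x - weight' b a y x) =
   6 * (chi3 x * a\<^sup>2 * (b * (1 - 9 * of_bool (3 dvd y))) +
        chi3 y * b\<^sup>2 * (a * (1 - 9 * of_bool (3 dvd x))))"
proof -
  have sum: "(x + y) mod 3 = (x mod 3 + y mod 3) mod 3" "(y + x) mod 3 = (x mod 3 + y mod 3) mod 3"
    by (simp_all add: mod_add_eq add.commute)
  have mods: "x mod 3 \<in> {0, 1, 2}" "y mod 3 \<in> {0, 1, 2}" by auto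
  note defs = weight'_def weight_def phi3_def chi3_def dvd_eq_mod_eq_0 sum
  show "weight' a b x y = weight' b a y x"
    unfolding defs using mods
    by (elim insertE emptyE; simp add: power2_eq_square power3_eq_cube; simp add: algebra_simps)
  show "2 * weight a b x y - weight' a b x y + (2 * weight b a y x - weight' b a y x) =
   6 * (chi3 x * a\<^sup>2 * (b * (1 - 9 * of_bool (3 dvd y))) +
        chi3 y * b\<^sup>2 * (a * (1 - 9 * of_bool (3 dvd x))))"
    unfolding defs using mods
    by (elim insertE emptyE; simp add: power2_eq_square power3_eq_cube; simp add: algebra_simps)
qed

section \<open>The convolution recurrence for \<open>twisted_sigma\<close>\<close>

lemma sum_weight_diagonal:
  fixes m :: int
  assumes "m > 0"
  shows "(\<Sum>a\<in>{1..m-1}. 6 * m * a\<^sup>2 - 8 * a ^ 3) = m ^ 3 - m\<^sup>2"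
proof -
  \<comment> \<open>The upper limit is decoupled from \<open>m\<close> to allow induction; the right
    side combines the standard sums of squares and cubes.\<close>
  have "(\<Sum>a\<in>{1..int n}. 6 * m * a\<^sup>2 - 8 * a ^ 3) =
      int n * (int n + 1) * (m * (2 * int n + 1) - 2 * int n * (int n + 1))" for n
  proof (induction n)
    case (Suc n)
    have "{1..int (Suc n)} = insert (int n + 1) {1..int n}" by auto
    thus ?case using Suc by (simp add: power2_eq_square power3_eq_cube algebra_simps)
  qed simp
  from this[of "nat (m - 1)"] assms show ?thesis
    by (simp add: power2_eq_square power3_eq_cube algebra_simps)
qed

text \<open>This is \<open>q S' = S L\<close> at \<open>q^(n-1)\<close>, where \<open>S\<close> has
  coefficients \<open>twisted_sigma (i + 1)\<close> and \<open>L\<close> has coefficients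
  \<open>log_coeff i\<close>; the shift explains the factor \<open>n - 1\<close>.\<close>

lemma twisted_sigma_recurrence:
  "(n - 1) * twisted_sigma n = (\<Sum>k\<in>{1..n-1}. twisted_sigma k * log_coeff (n - k))"
proof -
  let ?t = "\<lambda>a b x y. chi3 x * a\<^sup>2 * (b * (1 - 9 * of_bool (3 dvd y)))"
  let ?H = "\<lambda>a b x y. 2 * weight a b x y - weight' a b x y"
  \<comment> \<open>The sum is unchanged when its summand is symmetrised, and
    \<open>weight_sym\<close> evaluates the symmetrised summand.\<close>
  have "2 * (\<Sum>(a, b, x, y)\<in>quads n. ?H a b x y) =
      (\<Sum>(a, b, x, y)\<in>quads n. ?H a b x y) + (\<Sum>(a, b, x, y)\<in>quads n. ?H b a y x)"
    using sum_quads_swap[of ?H n] by simp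
  also have "\<dots> = (\<Sum>(a, b, x, y)\<in>quads n. 6 * (?t a b x y + ?t b a y x))"
    by (simp only: case_prod_unfold flip: sum.distrib weight_sym)
  also have "\<dots> = 6 * ((\<Sum>(a, b, x, y)\<in>quads n. ?t a b x y) + (\<Sum>(a, b, x, y)\<in>quads n. ?t b a y x))"
    by (simp only: case_prod_unfold sum_distrib_left sum.distrib distrib_left)
  also have "\<dots> = 12 * (\<Sum>(a, b, x, y)\<in>quads n. ?t a b x y)"
    using sum_quads_swap[of ?t n] by simp
  finally have 1: "(\<Sum>(a, b, x, y)\<in>quads n. ?H a b x y) = 6 * (\<Sum>(a, b, x, y)\<in>quads n. ?t a b x y)"
    by simp
  have 2: "3 * (\<Sum>(a, b, x, y)\<in>quads n. ?t a b x y) =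
      (\<Sum>k\<in>{1..n-1}. twisted_sigma k * log_coeff (n - k))"
  proof -
    have "log_coeff m = 3 * (\<Sum>(b, y)\<in>factor_pairs m. b * (1 - 9 * of_bool (3 dvd y)))" for m
      by (simp only: log_coeff_def sum_distrib_left case_prod_unfold mult.assoc)
    thus ?thesis
      unfolding sum_quads_product
      by (subst sum_distrib_left, intro sum.cong refl) (simp add: twisted_sigma_def)
  qed
  \<comment> \<open>On the diagonal \<open>phi3 x x = 2 * chi3 x\<close>.\<close>
  have 3: "(\<Sum>a\<in>{1..m-1}. weight a (m - a) x x) = chi3 x * (m ^ 3 - m\<^sup>2)" if "m > 0" for m x
  proof -
    have "weight a (m - a) x x = chi3 x * (6 * m * a\<^sup>2 - 8 * a ^ 3)" for a
      by (simp add: weight_def phi3_def chi3_def dvd_eq_mod_eq_0 power2_eq_square power3_eq_cube algebra_simps)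
    thus ?thesis
      unfolding sum_weight_diagonal[OF that, symmetric] by (simp add: sum_distrib_left)
  qed
  \<comment> \<open>With \<open>b = a\<close> one argument of each \<open>weight\<close> becomes 0;
    all that remains is the cubic term with \<open>chi3 (x + y) = chi3 m\<close>.\<close>
  have 4: "(\<Sum>x\<in>{1..m-1}. weight' a a x (m - x)) = - 2 * (m - 1) * chi3 m * a ^ 3" if "m > 0" for a m
    using that by (simp add: weight'_def weight_def) (simp add: algebra_simps)
  have "2 * (\<Sum>k\<in>{1..n-1}. twisted_sigma k * log_coeff (n - k)) =
      2 * (\<Sum>(m, x)\<in>factor_pairs n. \<Sum>a\<in>{1..m-1}. weight a (m - a) x x) -
      (\<Sum>(a, m)\<in>factor_pairs n. \<Sum>x\<in>{1..m-1}. weight' a a x (m - x))"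
    using sum_quads_identity[of weight' weight n, OF weight'_def weight'_sym] 1 2 by simp
  also have "(\<Sum>(m, x)\<in>factor_pairs n. \<Sum>a\<in>{1..m-1}. weight a (m - a) x x) =
      (\<Sum>(m, x)\<in>factor_pairs n. chi3 x * (m ^ 3 - m\<^sup>2))"
    using 3 by (intro sum.cong) (auto simp: factor_pairs_def)
  also have "(\<Sum>(a, m)\<in>factor_pairs n. \<Sum>x\<in>{1..m-1}. weight' a a x (m - x)) =
      (\<Sum>(a, m)\<in>factor_pairs n. - 2 * (m - 1) * chi3 m * a ^ 3)"
    using 4 by (intro sum.cong) (auto simp: factor_pairs_def)
  also have "2 * (\<Sum>(m, x)\<in>factor_pairs n. chi3 x * (m ^ 3 - m\<^sup>2)) - \<dots> =
      (\<Sum>(a, m)\<in>factor_pairs n. 2 * (chi3 m * (a ^ 3 - a\<^sup>2)) + 2 * (m - 1) * chi3 m * a ^ 3)"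
    unfolding sum_distrib_left sum_subtractf[symmetric] case_prod_unfold
    by (intro sum.cong refl) (simp add: algebra_simps)
  \<comment> \<open>The cubes cancel except for \<open>m * a ^ 3\<close>, which is
    \<open>n * a\<^sup>2\<close> because \<open>a * m = n\<close>.\<close>
  also have "\<dots> = (\<Sum>(a, m)\<in>factor_pairs n. 2 * ((n - 1) * (chi3 m * a\<^sup>2)))"
    by (intro sum.cong) (auto simp: factor_pairs_def power2_eq_square power3_eq_cube algebra_simps)
  also have "\<dots> = 2 * ((n - 1) * twisted_sigma n)"
    by (simp add: twisted_sigma_def sum_distrib_left case_prod_unfold)
  finally show ?thesis by simp
qed

section \<open>The product as an Eisenstein series\<close>

lemma fps_X_mult_deriv_nth: "fps_nth (fps_X * fps_deriv f) n = of_nat n * fps_nth f n"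
  for f :: "'a :: comm_ring_1 fps"
  by (simp add: fps_mult_fps_X_deriv_shift)

text \<open>The relation \<open>q f'/f = l\<close> with the denominator cleared.\<close>

definition has_log_deriv :: "rat fps \<Rightarrow> rat fps \<Rightarrow> bool" where
  "has_log_deriv f l \<longleftrightarrow> fps_X * fps_deriv f = f * l"

lemma has_log_deriv_1: "has_log_deriv 1 0"
  by (simp add: has_log_deriv_def)

lemma has_log_deriv_mult:
  "has_log_deriv f l \<Longrightarrow> has_log_deriv g m \<Longrightarrow> has_log_deriv (f * g) (l + m)"
  unfolding has_log_deriv_def fps_deriv_mult by algebra

lemma has_log_deriv_power:
  "has_log_deriv f l \<Longrightarrow> has_log_deriv (f ^ k) (of_nat k * l)"
proof (induction k)
  case (Suc k)
  from has_log_deriv_mult[OF Suc.prems Suc.IH[OF Suc.prems]] show ?case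
    by (simp add: algebra_simps)
qed (simp add: has_log_deriv_1)

lemma has_log_deriv_prod:
  "(\<And>x. x \<in> A \<Longrightarrow> has_log_deriv (f x) (l x)) \<Longrightarrow> has_log_deriv (\<Prod>x\<in>A. f x) (\<Sum>x\<in>A. l x)"
  by (induction A rule: infinite_finite_induct) (auto intro: has_log_deriv_1 has_log_deriv_mult)

text \<open>Differentiate \<open>f * inverse f = 1\<close> and cancel \<open>f\<close>.\<close>

lemma has_log_deriv_inverse:
  assumes "has_log_deriv f l" "fps_nth f 0 \<noteq> 0"
  shows "has_log_deriv (inverse f) (- l)"
proof -
  have inv: "f * inverse f = 1"
    using assms(2) by (rule inverse_mult_eq_1')
  have "fps_deriv f * inverse f + f * fps_deriv (inverse f) = 0"
    using arg_cong[OF inv, of fps_deriv] by (simp add: algebra_simps)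
  hence "fps_X * fps_deriv f * inverse f + f * (fps_X * fps_deriv (inverse f)) = 0"
    by algebra
  hence "f * (fps_X * fps_deriv (inverse f)) = f * (inverse f * (- l))"
    using assms(1) unfolding has_log_deriv_def by algebra
  moreover have "f \<noteq> 0" using assms(2) by auto
  ultimately show ?thesis
    unfolding has_log_deriv_def by (metis mult_left_cancel)
qed

text \<open>The expansion of \<open>j q^j / (1 - q^j)\<close>.\<close>

definition mult_series :: "nat \<Rightarrow> rat fps" where
  "mult_series j = Abs_fps (\<lambda>n. if n > 0 \<and> j dvd n then of_nat j else 0)"

lemma has_log_deriv_one_minus_X_power:
  assumes "j > 0"
  shows "has_log_deriv (1 - fps_X ^ j) (- mult_series j)"
  unfolding has_log_deriv_def
proof (rule fps_ext)
  fix n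
  have "fps_nth ((1 - fps_X ^ j) * mult_series j) n = (if n = j then of_nat j else 0)"
    using assms by (auto simp: left_diff_distrib fps_X_power_mult_nth mult_series_def dvd_minus_self not_less
        dest: dvd_imp_le)
  thus "fps_nth (fps_X * fps_deriv (1 - fps_X ^ j)) n = fps_nth ((1 - fps_X ^ j) * - mult_series j :: rat fps) n"
    using assms unfolding fps_X_mult_deriv_nth by simp
qed

text \<open>A finite truncation of \<open>eta(3 tau)^9 / eta(tau)^3\<close>, without its leading
  factor \<open>q\<close>.\<close>

definition eta_prod :: "nat \<Rightarrow> rat fps" where
  "eta_prod M = (\<Prod>j\<in>{1..M}. (1 - fps_X ^ (3 * j)) ^ 9 * inverse (1 - fps_X ^ j) ^ 3)"

lemma eta_prod_log_deriv:
  "has_log_deriv (eta_prod M) (\<Sum>j\<in>{1..M}. 3 * mult_series j - 9 * mult_series (3 * j))"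
  unfolding eta_prod_def
proof (rule has_log_deriv_prod)
  fix j assume "j \<in> {1..M}"
  hence "has_log_deriv ((1 - fps_X ^ (3 * j)) ^ 9 * inverse (1 - fps_X ^ j) ^ 3)
      (of_nat 9 * (- mult_series (3 * j)) + of_nat 3 * (- (- mult_series j)))"
    by (intro has_log_deriv_mult has_log_deriv_power has_log_deriv_inverse
        has_log_deriv_one_minus_X_power) auto
  thus "has_log_deriv ((1 - fps_X ^ (3 * j)) ^ 9 * inverse (1 - fps_X ^ j) ^ 3)
      (3 * mult_series j - 9 * mult_series (3 * j))"
    by simp
qed

text \<open>Only divisors \<open>j\<close> of \<open>n\<close> contribute at \<open>q^n\<close>, so
  truncation at any \<open>M \<ge> n\<close> is exact there.\<close>

lemma log_coeff_of_nat:
  assumes "n > 0" "n \<le> M"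
  shows "of_int (log_coeff (int n)) = fps_nth (\<Sum>j\<in>{1..M}. 3 * mult_series j - 9 * mult_series (3 * j)) n"
proof -
  have *: "int (n div nat b) = y \<and> nat b dvd n" if "b > 0" "y > 0" "b * y = int n" for b y
  proof -
    have "n = nat b * nat y"
      using that by (metis nat_int nat_mult_distrib less_imp_le)
    thus ?thesis using that by simp
  qed
  have "log_coeff (int n) = (\<Sum>j | j dvd n. 3 * int j * (1 - 9 * of_bool (3 dvd int (n div j))))"
    unfolding log_coeff_def
  proof (rule sum.reindex_bij_witness[of _ "\<lambda>j. (int j, int (n div j))" "\<lambda>(b, y). nat b"])
    fix j assume "j \<in> {j. j dvd n}"
    thus "(int j, int (n div j)) \<in> factor_pairs (int n)"
      using assms by (auto simp: factor_pairs_def elim!: dvdE)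
  qed (auto simp: factor_pairs_def *)
  \<comment> \<open>The condition on the codivisor becomes \<open>3 * j dvd n\<close>; the constant
    27 is 9 times the factor 3 in the coefficients \<open>3 * j\<close> of
    \<open>mult_series (3 * j)\<close>.\<close>
  also have "\<dots> = (\<Sum>j | j dvd n. 3 * int j - 27 * int j * of_bool (3 * j dvd n))"
  proof (intro sum.cong refl)
    fix j assume "j \<in> {j. j dvd n}"
    hence "j dvd n" "j \<noteq> 0" using assms by auto
    hence "3 dvd int (n div j) \<longleftrightarrow> 3 * j dvd n"
      using int_dvd_int_iff[of 3 "n div j"] by (simp add: dvd_div_iff_mult)
    thus "3 * int j * (1 - 9 * of_bool (3 dvd int (n div j))) = 3 * int j - 27 * int j * of_bool (3 * j dvd n)"
      by simp
  qed
  also have "of_int \<dots> = (\<Sum>j | j dvd n. 3 * of_nat j - 27 * of_nat j * of_bool (3 * j dvd n) :: rat)"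
    by (auto intro!: sum.cong)
  also have "\<dots> = (\<Sum>j\<in>{1..M}. fps_nth (3 * mult_series j - 9 * mult_series (3 * j)) n)"
  proof (rule sum.mono_neutral_cong_left)
    show "{j. j dvd n} \<subseteq> {1..M}"
    proof
      fix j assume "j \<in> {j. j dvd n}"
      hence "j > 0" "j \<le> n" using assms by (auto intro: dvd_pos_nat dvd_imp_le)
      thus "j \<in> {1..M}" using assms by simp
    qed
  qed (use assms in \<open>auto simp: mult_series_def numeral_fps_const intro: dvd_mult_left\<close>)
  finally show ?thesis by (simp add: fps_sum_nth)
qed

lemma fps_nth_prod_0:
  fixes f :: "'b \<Rightarrow> 'a :: comm_ring_1 fps"
  shows "fps_nth (\<Prod>x\<in>A. f x) 0 = (\<Prod>x\<in>A. fps_nth (f x) 0)"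
  by (induction A rule: infinite_finite_induct) auto

text \<open>Both sides start with 1 and satisfy the same recurrence, one by its logarithmic
  derivative and the other by \<open>twisted_sigma_recurrence\<close>.\<close>

lemma eta_prod_nth:
  assumes "n \<le> M"
  shows "fps_nth (eta_prod M) n = of_int (twisted_sigma (int n + 1))"
  using assms
proof (induction n rule: less_induct)
  case (less n)
  define W :: "rat fps" where "W = (\<Sum>j\<in>{1..M}. 3 * mult_series j - 9 * mult_series (3 * j))"
  have W0: "fps_nth W 0 = 0"
    by (simp add: W_def fps_sum_nth mult_series_def numeral_fps_const)
  show ?case
  proof (cases "n = 0")
    case True
    have "factor_pairs 1 = {(1, 1)}"
      by (auto simp: factor_pairs_def pos_zmult_eq_1_iff)
    thus ?thesis using True
      by (simp add: twisted_sigma_def chi3_def eta_prod_def fps_nth_prod_0 fps_power_zeroth power_0_left)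
  next
    case False
    have "of_nat n * fps_nth (eta_prod M) n = fps_nth (eta_prod M * W) n"
      using eta_prod_log_deriv[of M] unfolding has_log_deriv_def W_def
      by (metis fps_X_mult_deriv_nth)
    \<comment> \<open>Since \<open>W\<close> has constant term 0, only coefficients below
      \<open>n\<close> occur.\<close>
    also have "\<dots> = (\<Sum>i\<in>{0..<n}. fps_nth (eta_prod M) i * fps_nth W (n - i))"
      using W0 by (simp add: fps_mult_nth sum.last_plus atLeast0AtMost lessThan_atLeast0 flip: lessThan_Suc_atMost)
    also have "\<dots> = (\<Sum>i\<in>{0..<n}. of_int (twisted_sigma (int i + 1) * log_coeff (int (n - i))))"
    proof (rule sum.cong)
      fix i assume "i \<in> {0..<n}"
      thus "fps_nth (eta_prod M) i * fps_nth W (n - i) = of_int (twisted_sigma (int i + 1) * log_coeff (int (n - i)))"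
        using less log_coeff_of_nat[of "n - i" M] by (simp add: W_def)
    qed simp
    also have "\<dots> = of_int (\<Sum>k\<in>{1..int n}. twisted_sigma k * log_coeff (int n + 1 - k))"
      unfolding of_int_sum
      by (rule sum.reindex_bij_witness[of _ "\<lambda>k. nat (k - 1)" "\<lambda>i. int i + 1"]) (auto simp: of_nat_diff)
    also have "\<dots> = of_nat n * of_int (twisted_sigma (int n + 1))"
    proof -
      have "(\<Sum>k\<in>{1..int n}. twisted_sigma k * log_coeff (int n + 1 - k)) =
          int n * twisted_sigma (int n + 1)"
        using twisted_sigma_recurrence[of "int n + 1"] by simp
      thus ?thesis by (simp only: of_int_mult of_int_of_nat_eq)
    qed
    finally show ?thesis using False by simp
  qed
qed

section \<open>Reduction modulo 5\<close>

text \<open>Integral series congruent modulo 5 to a series in \<open>q^15\<close>. Divisibility is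
  spelled out with an integer witness because in \<open>rat\<close> it would be trivial.\<close>

definition mod5_in_X15 :: "rat fps \<Rightarrow> bool" where
  "mod5_in_X15 f \<longleftrightarrow> int_fps f \<and> (\<forall>n. \<not> 15 dvd n \<longrightarrow> (\<exists>k. fps_nth f n = 5 * of_int k))"

lemma ex_5_mult_Ints:
  "(\<exists>k. x = 5 * of_int k) \<Longrightarrow> y \<in> \<int> \<Longrightarrow> \<exists>k. x * y = 5 * (of_int k :: rat)"
  by (metis Ints_cases mult.assoc of_int_mult)

lemma ex_5_sum:
  "(\<And>i. i \<in> A \<Longrightarrow> \<exists>k. f i = 5 * of_int k) \<Longrightarrow> \<exists>k. (\<Sum>i\<in>A. f i) = 5 * (of_int k :: rat)"
proof (induction A rule: infinite_finite_induct)
  case (insert x A)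
  then obtain k l where "f x = 5 * of_int k" "(\<Sum>i\<in>A. f i) = 5 * of_int l" by blast
  thus ?case using insert.hyps by (intro exI[of _ "k + l"]) (simp add: algebra_simps)
qed (auto intro: exI[of _ 0])

text \<open>If 15 does not divide \<open>n\<close>, it fails to divide \<open>i\<close> or
  \<open>n - i\<close>, so each term of the convolution has a factor divisible by 5.\<close>

lemma mod5_in_X15_mult:
  assumes "mod5_in_X15 f" "mod5_in_X15 g"
  shows "mod5_in_X15 (f * g)"
  unfolding mod5_in_X15_def
proof (intro conjI allI impI)
  show "int_fps (f * g)"
    using assms by (auto simp: mod5_in_X15_def intro: int_fps_mult)
  fix n :: nat assume n: "\<not> 15 dvd n"
  show "\<exists>k. fps_nth (f * g) n = 5 * of_int k"
    unfolding fps_mult_nth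
  proof (rule ex_5_sum)
    fix i assume i: "i \<in> {0..n}"
    hence "\<not> 15 dvd i \<or> \<not> 15 dvd (n - i)"
      using n by (metis atLeastAtMost_iff dvd_diffD)
    thus "\<exists>k. fps_nth f i * fps_nth g (n - i) = 5 * of_int k"
      using assms ex_5_mult_Ints[of "fps_nth f i" "fps_nth g (n - i)"] ex_5_mult_Ints[of "fps_nth g (n - i)" "fps_nth f i"]
      by (auto simp: mod5_in_X15_def int_fps_def mult.commute)
  qed
qed

lemma mod5_in_X15_1: "mod5_in_X15 1"
  by (auto simp: mod5_in_X15_def int_fps_one)

lemma mod5_in_X15_prod:
  "(\<And>x. x \<in> A \<Longrightarrow> mod5_in_X15 (f x)) \<Longrightarrow> mod5_in_X15 (\<Prod>x\<in>A. f x)"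
  by (induction A rule: infinite_finite_induct) (auto simp: mod5_in_X15_1 mod5_in_X15_mult)

text \<open>Comparing coefficients in \<open>inverse f * f = 1\<close> expresses each coefficient of
  the inverse by earlier ones, and the argument for products applies to them.\<close>

lemma mod5_in_X15_inverse:
  assumes "mod5_in_X15 f" "fps_nth f 0 = 1"
  shows "mod5_in_X15 (inverse f)"
  unfolding mod5_in_X15_def
proof (intro conjI allI impI)
  show int: "int_fps (inverse f)"
    using assms by (intro int_fps_inverse) (auto simp: mod5_in_X15_def)
  fix n :: nat assume "\<not> 15 dvd n"
  thus "\<exists>k. fps_nth (inverse f) n = 5 * of_int k"
  proof (induction n rule: less_induct)
    case (less n)
    have inv: "inverse f * f = 1"
      using assms(2) by (simp add: inverse_mult_eq_1)
    have n: "n > 0" using less.prems by (cases "n = 0") auto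
    have "\<exists>k. (\<Sum>i\<in>{0..<n}. fps_nth (inverse f) i * fps_nth f (n - i)) = 5 * of_int k"
    proof (rule ex_5_sum)
      fix i assume i: "i \<in> {0..<n}"
      show "\<exists>k. fps_nth (inverse f) i * fps_nth f (n - i) = 5 * of_int k"
      proof (cases "15 dvd i")
        case True
        hence "\<not> 15 dvd (n - i)"
          using less.prems i by (metis atLeastLessThan_iff dvd_diffD less_imp_le_nat)
        thus ?thesis
          using assms int ex_5_mult_Ints[of "fps_nth f (n - i)" "fps_nth (inverse f) i"]
          by (auto simp: mod5_in_X15_def int_fps_def mult.commute)
      next
        case False
        thus ?thesis
          using assms i less.IH[of i] ex_5_mult_Ints[of "fps_nth (inverse f) i" "fps_nth f (n - i)"]
          by (auto simp: mod5_in_X15_def int_fps_def)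
      qed
    qed
    then obtain k where k: "(\<Sum>i\<in>{0..<n}. fps_nth (inverse f) i * fps_nth f (n - i)) = 5 * of_int k" ..
    have "0 = fps_nth (inverse f * f) n" using n inv by simp
    also have "\<dots> = (\<Sum>i\<in>{0..<n}. fps_nth (inverse f) i * fps_nth f (n - i)) + fps_nth (inverse f) n"
      using assms(2) by (simp add: fps_mult_nth atLeast0AtMost lessThan_atLeast0 flip: lessThan_Suc_atMost)
    finally have "fps_nth (inverse f) n = 5 * of_int (- k)" using k by simp
    thus ?case ..
  qed
qed

text \<open>Frobenius: \<open>(1 - Y)^5\<close> is \<open>1 - Y^5\<close> modulo 5, and here
  \<open>Y^5 = q^(15j)\<close>.\<close>

lemma mod5_in_X15_power5: "mod5_in_X15 ((1 - fps_X ^ (3 * j)) ^ 5)"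
proof -
  define Y :: "nat \<Rightarrow> rat fps" where "Y i = fps_X ^ (i * (3 * j))" for i
  \<comment> \<open>The inner binomial terms of \<open>(1 - Y)^5\<close> divided by 5, with each
    coefficient 2 written as a repeated term so that integrality needs only sums and
    differences.\<close>
  define E where "E = Y 2 + Y 2 + Y 4 - Y 1 - Y 3 - Y 3"
  have Y: "Y i = Y 1 ^ i" for i
    by (simp add: Y_def mult.commute flip: power_mult)
  have "(1 - Y 1) ^ 5 = 1 - Y 5 + fps_const 5 * E"
    unfolding E_def Y[of 2] Y[of 3] Y[of 4] Y[of 5] numeral_fps_const[symmetric] by algebra
  also have "mod5_in_X15 \<dots>"
    unfolding mod5_in_X15_def
  proof (intro conjI allI impI)
    have Y_int: "fps_nth (Y i) n \<in> \<int>" for i n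
      by (simp add: Y_def)
    have E_int: "fps_nth E n \<in> \<int>" for n
      unfolding E_def fps_add_nth fps_sub_nth by (intro Ints_add Ints_diff Y_int)
    thus "int_fps (1 - Y 5 + fps_const 5 * E)"
      unfolding int_fps_def using Y_int[of 5] by (auto intro!: Ints_add Ints_diff Ints_mult)
    fix n :: nat assume n: "\<not> 15 dvd n"
    have "n \<noteq> 5 * (3 * j)" "n \<noteq> 0" using n by (auto intro!: Nat.gr0I)
    hence "fps_nth (1 - Y 5 + fps_const 5 * E) n = 5 * fps_nth E n"
      by (simp add: Y_def)
    thus "\<exists>k. fps_nth (1 - Y 5 + fps_const 5 * E) n = 5 * of_int k"
      using E_int[of n] by (auto elim: Ints_cases)
  qed
  finally show ?thesis by (simp add: Y_def)
qed

section \<open>Divisibility of the Eisenstein coefficients by 5\<close>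

lemma twisted_sigma_dvd_5:
  assumes "n mod 3 = 1" "n mod 5 = 2 \<or> n mod 5 = 3"
  shows "5 dvd twisted_sigma n"
proof -
  \<comment> \<open>Averaging over the exchange of divisor and codivisor costs a factor 2, which is
    invertible modulo 5.\<close>
  have "2 * twisted_sigma n = (\<Sum>(a, x)\<in>factor_pairs n. chi3 x * a\<^sup>2) + (\<Sum>(a, x)\<in>factor_pairs n. chi3 a * x\<^sup>2)"
  proof -
    have "(\<Sum>(a, x)\<in>factor_pairs n. chi3 x * a\<^sup>2) = (\<Sum>(a, x)\<in>factor_pairs n. chi3 a * x\<^sup>2)"
      by (rule sum.reindex_bij_witness[of _ prod.swap prod.swap]) (auto simp: factor_pairs_def mult.commute)
    thus ?thesis by (simp add: twisted_sigma_def)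
  qed
  also have "\<dots> = (\<Sum>(a, x)\<in>factor_pairs n. chi3 x * a\<^sup>2 + chi3 a * x\<^sup>2)"
    by (simp add: case_prod_unfold sum.distrib)
  also have "5 dvd \<dots>"
  proof (rule dvd_sum)
    fix p assume "p \<in> factor_pairs n"
    then obtain a x where p: "p = (a, x)" "a * x = n" by (auto simp: factor_pairs_def)
    have "(a mod 3) * (x mod 3) mod 3 = 1"
      using assms p by (simp add: mod_mult_eq)
    moreover have "a mod 3 \<in> {0, 1, 2}" "x mod 3 \<in> {0, 1, 2}" by auto
    ultimately have chi: "chi3 a = chi3 x" by (auto simp: chi3_def)
    \<comment> \<open>Here \<open>a * x\<close> is 2 or -2 modulo 5, so the squares of
      \<open>a\<close> and \<open>x\<close> have product -1; they are therefore 1 and -1 in some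
      order.\<close>
    have "(a mod 5) * (x mod 5) mod 5 = 2 \<or> (a mod 5) * (x mod 5) mod 5 = 3"
      using assms p by (simp add: mod_mult_eq)
    moreover have "a mod 5 \<in> {0, 1, 2, 3, 4}" "x mod 5 \<in> {0, 1, 2, 3, 4}" by auto
    ultimately have "((a mod 5)\<^sup>2 + (x mod 5)\<^sup>2) mod 5 = 0"
      by auto
    moreover have "(a\<^sup>2 + x\<^sup>2) mod 5 = ((a mod 5)\<^sup>2 + (x mod 5)\<^sup>2) mod 5"
      by (intro mod_add_cong) (simp_all add: power_mod)
    ultimately have "5 dvd a\<^sup>2 + x\<^sup>2" by presburger
    hence "5 dvd chi3 x * (a\<^sup>2 + x\<^sup>2)" by simp
    thus "5 dvd (case p of (a, x) \<Rightarrow> chi3 x * a\<^sup>2 + chi3 a * x\<^sup>2)"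
      by (simp add: p chi algebra_simps)
  qed
  finally have "5 dvd 2 * twisted_sigma n" .
  thus ?thesis by presburger
qed

text \<open>A long enough finite product already has the coefficient \<open>a n\<close> and splits
  as \<open>eta_prod M * R\<close>. In the convolution, either the coefficient of \<open>R\<close>
  is divisible by 5, or \<open>i\<close> is congruent to \<open>n\<close> modulo 15 and the
  Eisenstein coefficient is.\<close>

lemma coeff_dvd_5:
  fixes a :: "nat \<Rightarrow> int"
  assumes "(\<lambda>k. 1 / ((1 - fps_X ^ (3 * Suc k)) * (1 - fps_X ^ Suc k) ^ 3))
             has_prod (Abs_fps (\<lambda>n. of_int (a n)) :: rat fps)"
  assumes n: "n mod 15 = 6 \<or> n mod 15 = 12"
  shows "5 dvd a n"
proof -
  let ?F = "\<lambda>k. 1 / ((1 - fps_X ^ (3 * Suc k)) * (1 - fps_X ^ Suc k) ^ 3) :: rat fps"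
  have "(\<lambda>m. \<Prod>k<m. ?F k) \<longlonglongrightarrow> Abs_fps (\<lambda>n. of_int (a n))"
    by (rule has_prod_imp_tendsto') fact
  hence "\<forall>\<^sub>F m in sequentially. fps_nth (\<Prod>k<m. ?F k) n = of_int (a n)"
    unfolding tendsto_fps_iff by simp
  \<comment> \<open>The bound \<open>m \<ge> n\<close> is what \<open>eta_prod_nth\<close> requires
    at every index up to \<open>n\<close>.\<close>
  hence "\<forall>\<^sub>F m in sequentially. fps_nth (\<Prod>k<m. ?F k) n = of_int (a n) \<and> m \<ge> n"
    using eventually_ge_at_top[of n] by (rule eventually_conj)
  then obtain M where M: "fps_nth (\<Prod>k<M. ?F k) n = of_int (a n)" "M \<ge> n"
    by (auto simp: eventually_sequentially)
  define R :: "rat fps" where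
    "R = (\<Prod>j\<in>{1..M}. inverse ((1 - fps_X ^ (3 * j)) ^ 5) * inverse ((1 - fps_X ^ (3 * j)) ^ 5))"
  have R: "mod5_in_X15 R"
    unfolding R_def
    by (intro mod5_in_X15_prod mod5_in_X15_mult mod5_in_X15_inverse mod5_in_X15_power5)
       (auto simp: fps_power_zeroth power_0_left)
  have "(\<Prod>k<M. ?F k) = (\<Prod>j\<in>{1..M}. 1 / ((1 - fps_X ^ (3 * j)) * (1 - fps_X ^ j) ^ 3))"
    by (rule prod.reindex_bij_witness[of _ "\<lambda>j. j - 1" Suc]) auto
  also have "\<dots> = (\<Prod>j\<in>{1..M}. (1 - fps_X ^ (3 * j)) ^ 9 * inverse (1 - fps_X ^ j) ^ 3 *
      (inverse ((1 - fps_X ^ (3 * j)) ^ 5) * inverse ((1 - fps_X ^ (3 * j)) ^ 5)))"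
  proof (rule prod.cong)
    fix j assume j: "j \<in> {1..M}"
    define U V :: "rat fps" where "U = 1 - fps_X ^ (3 * j)" and "V = 1 - fps_X ^ j"
    have U0: "fps_nth U 0 = 1" "fps_nth V 0 = 1" using j by (auto simp: U_def V_def)
    have inv: "U * inverse U = 1" "V * inverse V = 1"
      using U0 by (simp_all add: inverse_mult_eq_1')
    have "1 / (U * V ^ 3) = inverse U * inverse V ^ 3"
      using U0 by (simp add: fps_divide_unit fps_inverse_mult fps_inverse_power fps_power_zeroth)
    \<comment> \<open>The exponent -1 of \<open>U\<close> is written as 9 - 10, the 10 being two
      fifth powers.\<close>
    also have "\<dots> = (U * inverse U) ^ 9 * (inverse U * inverse V ^ 3)"
      using inv by simp
    also have "\<dots> = U ^ 9 * inverse V ^ 3 * (inverse (U ^ 5) * inverse (U ^ 5))"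
      by (simp add: fps_inverse_power power_mult_distrib) (simp add: eval_nat_numeral mult_ac)
    finally show "1 / (U * V ^ 3) = U ^ 9 * inverse V ^ 3 * (inverse (U ^ 5) * inverse (U ^ 5))" .
  qed simp
  also have "\<dots> = eta_prod M * R"
    by (simp only: prod.distrib eta_prod_def R_def)
  finally have "of_int (a n) = (\<Sum>i=0..n. fps_nth (eta_prod M) i * fps_nth R (n - i))"
    using M(1) by (simp add: fps_mult_nth)
  moreover have "\<exists>k. (\<Sum>i=0..n. fps_nth (eta_prod M) i * fps_nth R (n - i)) = 5 * of_int k"
  proof (rule ex_5_sum)
    fix i assume i: "i \<in> {0..n}"
    hence E: "fps_nth (eta_prod M) i = of_int (twisted_sigma (int i + 1))"
      using M(2) by (intro eta_prod_nth) auto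
    show "\<exists>k. fps_nth (eta_prod M) i * fps_nth R (n - i) = 5 * of_int k"
    proof (cases "15 dvd n - i")
      case True
      hence "i mod 15 = n mod 15"
        using i by (metis atLeastAtMost_iff mod_eq_dvd_iff_nat)
      \<comment> \<open>Modulo 15, \<open>i + 1\<close> is 7 or 13: both are 1 modulo 3, and they
        are 2 and 3 modulo 5.\<close>
      hence "5 dvd twisted_sigma (int i + 1)"
        using n by (intro twisted_sigma_dvd_5) presburger+
      then obtain k where "twisted_sigma (int i + 1) = 5 * k" ..
      hence "\<exists>k. fps_nth (eta_prod M) i = 5 * of_int k"
        unfolding E by (intro exI[of _ k]) simp
      thus ?thesis
        using R by (intro ex_5_mult_Ints) (auto simp: mod5_in_X15_def int_fps_def)
    next
      case False
      hence "\<exists>k. fps_nth R (n - i) * fps_nth (eta_prod M) i = 5 * of_int k"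
        using R by (intro ex_5_mult_Ints) (auto simp: mod5_in_X15_def E)
      thus ?thesis by (simp add: mult.commute)
    qed
  qed
  ultimately obtain k where "(of_int (a n) :: rat) = 5 * of_int k" by auto
  hence "(of_int (a n) :: rat) = of_int (5 * k)" by simp
  hence "a n = 5 * k" by (simp only: of_int_eq_iff)
  thus ?thesis by simp
qed

theorem theorem1p1:
  fixes a :: "nat \<Rightarrow> int"
  assumes "(\<lambda>k. 1 / ((1 - fps_X ^ (3 * Suc k)) * (1 - fps_X ^ Suc k) ^ 3))
             has_prod (Abs_fps (\<lambda>n. of_int (a n)) :: rat fps)"
  shows "\<forall>n. [a (15 * n + 6) = 0] (mod 5) \<and> [a (15 * n + 12) = 0] (mod 5)"
proof (intro allI conjI)
  fix n
  show "[a (15 * n + 6) = 0] (mod 5)"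
    using coeff_dvd_5[OF assms, of "15 * n + 6"] by (simp add: cong_0_iff)
  show "[a (15 * n + 12) = 0] (mod 5)"
    using coeff_dvd_5[OF assms, of "15 * n + 12"] by (simp add: cong_0_iff)
qed

end
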